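(* Let $n\ge1$ and $\mathbf{k}=(k_1\le k_2\le\cdots\le k_n)\in\mathbb{Z}^n$. The number $\alpha(n;\mathbf{k})$ of monotone triangles with bottom row $\mathbf{k}$ is given by \[ \alpha(n;\mathbf{k})=\sum_{G\in\mathcal{Q}_{\mathrm{ess}}}(-1)^{|I(G)|}\,\Omega_{\mathrm{GT}_n/G,A/G}(\mathbf{k}), \] and thus is a polynomial (there is a polynomial in $k_1,\dots,k_n$ agreeing with $\alpha(n;\mathbf{k})$ for all such $\mathbf{k}$). In particular $\alpha(n;\mathbf{k})=0$ whenever $k_j=k_{j+1}=k_{j+2}$ for some $j$.
   Context: A monotone triangle with bottom row $\mathbf{k}$ is an integer array $(a_{i,j})_{1\le j\le i\le n}$ with $a_{n,j}=k_j$, $a_{i,j}\le a_{i-1,j}$ ($1\le j<i\le n$), $a_{i,j}\le a_{i+1,j+1}$ ($1\le j\le i<n$), and $a_{i,j}<a_{i,j+1}$ ($1\le j<i<n$). $\mathrm{GT}_n$ is the poset on $\{(i,j):1\le j\le i\le n\}$ with $(i,j)\preceq(k,l)$ iff $k-i\le l-j$ and $j\le l$; $A=\{(n,1),\dots,(n,n)\}$ and $\mathbf{k}$ is viewed as the map $(n,j)\mapsto k_j$. $\mathrm{bad}_n=\{(i,j):1\le j<i<n\}$. For $(i,j)\in\mathrm{bad}_n$ the diamond $G_{ij}$ is the set of cover relations $(i,j)\prec(i-1,j)$, $(i,j)\prec(i+1,j+1)$, $(i-1,j)\prec(i,j+1)$, $(i+1,j+1)\prec(i,j+1)$. A diamond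 poset $G$ is a (possibly empty) union of diamonds; $I(G)=\{(i,j)\in\mathrm{bad}_n:G_{ij}\subseteq G\}$; $G$ is closed if $G_{i,j}\cup G_{i,j+1}\subseteq G$ implies $G_{i-1,j}\cup G_{i+1,j+1}\subseteq G$. $\mathcal{Q}_{\mathrm{ess}}$ is the set of closed diamond posets $G$ with no $(i,j)$ such that both $(i,j),(i,j+1)\in I(G)$. $\mathrm{GT}_n/G$ is the quotient poset obtained by contracting the cover relations of $G$ (elements: connected components of $G$), $A/G$ the image of $A$, and $\Omega_{\mathrm{GT}_n/G,A/G}(\mathbf{k})$ is the number of integer-valued order preserving maps on $\mathrm{GT}_n/G$ extending the map induced by $\mathbf{k}$ on $A/G$; equivalently, the number of order preserving $a:\mathrm{GT}_n\to\mathbb{Z}$ with $a(n,j)=k_j$ for all $j$ and $a(p)=a(q)$ for every cover relation $p\prec q$ in $G$. *)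

theory Defs
  imports Complex_Main "HOL-Library.FuncSet" "HOL-Library.Poly_Mapping"
begin

section \<open>Monotone triangles\<close>

type_synonym pos = "nat \<times> nat"

definition GT :: "nat \<Rightarrow> pos set" where
  "GT n = {(i, j). 1 \<le> j \<and> j \<le> i \<and> i \<le> n}"

text \<open>A bottom row is a function \<open>k :: nat \<Rightarrow> int\<close>, of which only the values at \<open>1, \<dots>, n\<close> matter.
  Arrays are extensional functions on \<open>GT n\<close>, so that counting functions counts arrays.\<close>

definition monotone_triangles :: "nat \<Rightarrow> (nat \<Rightarrow> int) \<Rightarrow> (pos \<Rightarrow> int) set" where
  "monotone_triangles n k = {a \<in> GT n \<rightarrow>\<^sub>E UNIV.
     (\<forall>j\<in>{1..n}. a (n, j) = k j) \<and>
     (\<forall>i j. 1 \<le> j \<and> j < i \<and> i \<le> n \<longrightarrow> a (i, j) \<le> a (i - 1, j)) \<and>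
     (\<forall>i j. 1 \<le> j \<and> j \<le> i \<and> i < n \<longrightarrow> a (i, j) \<le> a (i + 1, j + 1)) \<and>
     (\<forall>i j. 1 \<le> j \<and> j < i \<and> i < n \<longrightarrow> a (i, j) < a (i, j + 1))}"

definition alpha :: "nat \<Rightarrow> (nat \<Rightarrow> int) \<Rightarrow> nat" where
  "alpha n k = card (monotone_triangles n k)"


section \<open>The Gelfand-Tsetlin poset and diamond posets\<close>

definition GT_le :: "pos \<Rightarrow> pos \<Rightarrow> bool" where
  "GT_le p q \<longleftrightarrow> (case (p, q) of ((i, j), (k, l)) \<Rightarrow>
     int k - int i \<le> int l - int j \<and> j \<le> l)"

definition bottom :: "nat \<Rightarrow> pos set" where
  "bottom n = {(n, j) | j. 1 \<le> j \<and> j \<le> n}"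

definition bad :: "nat \<Rightarrow> pos set" where
  "bad n = {(i, j). 1 \<le> j \<and> j < i \<and> i < n}"

text \<open>A cover relation \<open>p \<prec> q\<close> is the pair \<open>(p, q)\<close>, smaller element first.\<close>

fun diamond :: "pos \<Rightarrow> (pos \<times> pos) set" where
  "diamond (i, j) =
     {((i, j), (i - 1, j)), ((i, j), (i + 1, j + 1)),
      ((i - 1, j), (i, j + 1)), ((i + 1, j + 1), (i, j + 1))}"

definition diamond_poset :: "nat \<Rightarrow> (pos \<times> pos) set \<Rightarrow> bool" where
  "diamond_poset n G \<longleftrightarrow> (\<exists>S \<subseteq> bad n. G = (\<Union>p\<in>S. diamond p))"

definition I_set :: "nat \<Rightarrow> (pos \<times> pos) set \<Rightarrow> pos set" where
  "I_set n G = {p \<in> bad n. diamond p \<subseteq> G}"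

text \<open>A diamond exists only at positions in \<open>bad n\<close>. For \<open>i = n - 1\<close> there is no diamond at
  \<open>(i + 1, j + 1)\<close>, and closedness then asks nothing about that position.\<close>

definition closed_diamond_poset :: "nat \<Rightarrow> (pos \<times> pos) set \<Rightarrow> bool" where
  "closed_diamond_poset n G \<longleftrightarrow> diamond_poset n G \<and>
     (\<forall>i j. (i, j) \<in> bad n \<and> (i, j + 1) \<in> bad n \<and> diamond (i, j) \<union> diamond (i, j + 1) \<subseteq> G \<longrightarrow>
        (\<forall>p \<in> {(i - 1, j), (i + 1, j + 1)} \<inter> bad n. diamond p \<subseteq> G))"

definition Q_ess :: "nat \<Rightarrow> (pos \<times> pos) set set" where
  "Q_ess n = {G. closed_diamond_poset n G \<and>
     \<not> (\<exists>i j. (i, j) \<in> I_set n G \<and> (i, j + 1) \<in> I_set n G)}"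


section \<open>Quotients and extensions of the bottom row\<close>

definition connected_rel :: "(pos \<times> pos) set \<Rightarrow> (pos \<times> pos) set" where
  "connected_rel G = (G \<union> G\<inverse>)\<^sup>*"

definition GT_quot :: "nat \<Rightarrow> (pos \<times> pos) set \<Rightarrow> pos set set" where
  "GT_quot n G = GT n // connected_rel G"

definition bottom_quot :: "nat \<Rightarrow> (pos \<times> pos) set \<Rightarrow> pos set set" where
  "bottom_quot n G = bottom n // connected_rel G"

text \<open>The order on the quotient is the transitive closure of the image of the order of \<open>GT n\<close>.\<close>

definition quot_order :: "nat \<Rightarrow> (pos \<times> pos) set \<Rightarrow> (pos set \<times> pos set) set" where
  "quot_order n G =
     {(C, D). C \<in> GT_quot n G \<and> D \<in> GT_quot n G \<and> (\<exists>p\<in>C. \<exists>q\<in>D. GT_le p q)}\<^sup>+"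

text \<open>The last condition says that \<open>f\<close> extends the map induced by \<open>(n, j) \<mapsto> k j\<close> on the image of
  the bottom row. If \<open>k\<close> takes different values on a single component, it induces no map there
  and the number of extensions is \<open>0\<close>.\<close>

definition Omega :: "nat \<Rightarrow> (pos \<times> pos) set \<Rightarrow> (nat \<Rightarrow> int) \<Rightarrow> nat" where
  "Omega n G k = card {f \<in> GT_quot n G \<rightarrow>\<^sub>E (UNIV :: int set).
     (\<forall>(C, D) \<in> quot_order n G. f C \<le> f D) \<and>
     (\<forall>C \<in> bottom_quot n G. \<forall>j. (n, j) \<in> C \<inter> bottom n \<longrightarrow> f C = k j)}"


section \<open>Multivariate polynomials\<close>

text \<open>A polynomial maps exponent vectors to coefficients, both finitely supported.\<close>

type_synonym mpol = "(nat \<Rightarrow>\<^sub>0 nat) \<Rightarrow>\<^sub>0 rat"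

definition mpol_in :: "nat set \<Rightarrow> mpol \<Rightarrow> bool" where
  "mpol_in V P \<longleftrightarrow> (\<forall>m \<in> Poly_Mapping.keys P. Poly_Mapping.keys m \<subseteq> V)"

definition mpol_eval :: "mpol \<Rightarrow> (nat \<Rightarrow> rat) \<Rightarrow> rat" where
  "mpol_eval P x = (\<Sum>m \<in> Poly_Mapping.keys P.
     Poly_Mapping.lookup P m * (\<Prod>i \<in> Poly_Mapping.keys m. x i ^ Poly_Mapping.lookup m i))"

end

(* A monotone triangle is a Gelfand-Tsetlin pattern without violations, a violation being a position
   in bad n where two horizontally adjacent entries agree. Essential diamond posets correspond to
   the sets S of positions in bad n without horizontal neighbours, and the summand of S counts the
   patterns violated on all of S. A violation at (i, j) and (i, j + 1) forces one at (i - 1, j), so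
   the violations of the topmost violated row have no horizontal neighbours among the violations;
   adding or removing one of them from S cancels the contribution of every violated pattern.

   Polynomiality is proved by induction on n. Strict rows interlacing with the bottom row are summed
   entry by entry; correcting for two equal adjacent entries fixes both of them, and a further equal
   entry contributes nothing because alpha vanishes on triples. All sums run over intervals that are
   nonempty for weakly increasing k, where indefinite summation keeps polynomials polynomial. *)

theory Submission
  imports Defs "HOL-Computational_Algebra.Polynomial"
begin

section \<open>Polynomial functions\<close>

definition mono_eval :: "(nat \<Rightarrow>\<^sub>0 nat) \<Rightarrow> (nat \<Rightarrow> rat) \<Rightarrow> rat" where
  "mono_eval m x = (\<Prod>i\<in>Poly_Mapping.keys m. x i ^ Poly_Mapping.lookup m i)"

lemma mono_eval_superset:
  assumes "finite A" "Poly_Mapping.keys m \<subseteq> A"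
  shows "mono_eval m x = (\<Prod>i\<in>A. x i ^ Poly_Mapping.lookup m i)"
  unfolding mono_eval_def
  by (rule prod.mono_neutral_left) (use assms in \<open>auto simp: in_keys_iff\<close>)

lemma mono_eval_add: "mono_eval (m + m') x = mono_eval m x * mono_eval m' x"
proof -
  let ?A = "Poly_Mapping.keys m \<union> Poly_Mapping.keys m'"
  have "Poly_Mapping.keys (m + m') \<subseteq> ?A" by (rule Poly_Mapping.keys_add)
  then show ?thesis
    using mono_eval_superset[of ?A m x] mono_eval_superset[of ?A m' x]
      mono_eval_superset[of ?A "m + m'" x]
    by (simp add: lookup_add power_add prod.distrib)
qed

lemma mono_eval_0 [simp]: "mono_eval 0 x = 1"
  by (simp add: mono_eval_def)

text \<open>Polynomials are handled as functions, so that closure properties follow by induction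
  over monomials and sums. A representing \<open>mpol\<close> is recovered only at the end, by
  \<open>polyfun_mpol_eval\<close>.\<close>

inductive_set polyfun :: "nat set \<Rightarrow> ((nat \<Rightarrow> rat) \<Rightarrow> rat) set" for V where
  monom: "Poly_Mapping.keys m \<subseteq> V \<Longrightarrow> (\<lambda>x. c * mono_eval m x) \<in> polyfun V"
| add: "f \<in> polyfun V \<Longrightarrow> g \<in> polyfun V \<Longrightarrow> (\<lambda>x. f x + g x) \<in> polyfun V"

lemma polyfun_const: "(\<lambda>x. c) \<in> polyfun V"
  using polyfun.monom[of 0 V c] by simp

lemma polyfun_var:
  assumes "i \<in> V" shows "(\<lambda>x. x i) \<in> polyfun V"
proof -
  have "mono_eval (Poly_Mapping.single i 1) x = x i" for x
    by (simp add: mono_eval_def)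
  then show ?thesis
    using polyfun.monom[of "Poly_Mapping.single i 1" V 1] assms by simp
qed

lemma polyfun_mult:
  assumes "f \<in> polyfun V" "g \<in> polyfun V"
  shows "(\<lambda>x. f x * g x) \<in> polyfun V"
  using assms
proof (induction rule: polyfun.induct)
  case (monom m c)
  from monom(2) show ?case
  proof (induction rule: polyfun.induct)
    case (monom m' c')
    have "Poly_Mapping.keys (m + m') \<subseteq> V"
      using Poly_Mapping.keys_add[of m m'] \<open>Poly_Mapping.keys m \<subseteq> V\<close> monom by blast
    from polyfun.monom[OF this, of "c * c'"] show ?case
      by (simp add: mono_eval_add mult_ac)
  next
    case (add f g)
    show ?case using polyfun.add[OF add.IH] by (simp add: distrib_left)
  qed
next
  case (add f1 f2)
  show ?case using polyfun.add[OF add.IH(1) add.IH(2)] add.prems by (simp add: distrib_right)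
qed

lemma polyfun_diff:
  assumes "f \<in> polyfun V" "g \<in> polyfun V"
  shows "(\<lambda>x. f x - g x) \<in> polyfun V"
  using polyfun.add[OF assms(1) polyfun_mult[OF polyfun_const[of "-1"] assms(2)]] by simp

lemma polyfun_prod:
  assumes "\<And>i. i \<in> A \<Longrightarrow> f i \<in> polyfun V"
  shows "(\<lambda>x. \<Prod>i\<in>A. f i x) \<in> polyfun V"
  using assms
  by (induction A rule: infinite_finite_induct) (simp_all add: polyfun_const polyfun_mult)

lemma polyfun_power: "f \<in> polyfun V \<Longrightarrow> (\<lambda>x. f x ^ e) \<in> polyfun V"
  by (induction e) (simp_all add: polyfun_const polyfun_mult)

lemma polyfun_poly: "f \<in> polyfun V \<Longrightarrow> (\<lambda>x. poly q (f x)) \<in> polyfun V"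
  by (induction q) (simp_all add: polyfun_const polyfun_mult polyfun.add)

lemma polyfun_compose:
  assumes "f \<in> polyfun V" "\<And>i. i \<in> V \<Longrightarrow> (\<lambda>x. s x i) \<in> polyfun W"
  shows "(\<lambda>x. f (s x)) \<in> polyfun W"
  using assms(1)
proof (induction rule: polyfun.induct)
  case (monom m c)
  then show ?case unfolding mono_eval_def
    by (intro polyfun_mult polyfun_const polyfun_prod polyfun_power assms(2)) auto
next
  case (add f g)
  show ?case by (rule polyfun.add[OF add.IH])
qed

lemma polyfun_upd:
  assumes "f \<in> polyfun V" "g \<in> polyfun V"
  shows "(\<lambda>x. f (x(j := g x))) \<in> polyfun V"
proof (rule polyfun_compose[OF assms(1)])
  fix i assume "i \<in> V"
  then show "(\<lambda>x. (x(j := g x)) i) \<in> polyfun V"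
    by (cases "i = j") (simp_all add: assms(2) polyfun_var)
qed

lemma polyfun_mono:
  assumes "f \<in> polyfun V" "V \<subseteq> W" shows "f \<in> polyfun W"
  using polyfun_compose[OF assms(1), of "\<lambda>x. x" W] assms(2) by (simp add: polyfun_var subset_iff)

lemma polyfun_mpol_eval:
  assumes "f \<in> polyfun V"
  shows "\<exists>P. mpol_in V P \<and> (\<forall>x. f x = mpol_eval P x)"
  using assms
proof (induction rule: polyfun.induct)
  case (monom m c)
  then show ?case
    by (intro exI[of _ "Poly_Mapping.single m c"])
      (auto simp: mpol_in_def mpol_eval_def mono_eval_def)
next
  case (add f g)
  then obtain P Q where PQ: "mpol_in V P" "mpol_in V Q"
    "\<And>x. f x = mpol_eval P x" "\<And>x. g x = mpol_eval Q x" by blast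
  let ?A = "Poly_Mapping.keys P \<union> Poly_Mapping.keys Q"
  \<comment> \<open>Cancellation can make the support of \<open>P + Q\<close> smaller than
    \<open>?A\<close>. Written over the common index set \<open>?A\<close>, where missing exponents
    have coefficient 0, evaluation becomes additive.\<close>
  have sup: "mpol_eval R x = (\<Sum>m\<in>?A. Poly_Mapping.lookup R m * mono_eval m x)"
    if "Poly_Mapping.keys R \<subseteq> ?A" for R x
    unfolding mpol_eval_def mono_eval_def
    by (rule sum.mono_neutral_left) (use that in \<open>auto simp: in_keys_iff\<close>)
  have k: "Poly_Mapping.keys (P + Q) \<subseteq> ?A" by (rule Poly_Mapping.keys_add)
  have "mpol_in V (P + Q)" using PQ k unfolding mpol_in_def by blast
  moreover have "f x + g x = mpol_eval (P + Q) x" for x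
    by (simp add: PQ sup k lookup_add distrib_right sum.distrib)
  ultimately show ?case by blast
qed

section \<open>Indefinite summation of polynomials\<close>

text \<open>By the binomial theorem \<open>y ^ Suc e - (y - 1) ^ Suc e\<close> is
  \<open>Suc e\<close> times \<open>y ^ e\<close> up to powers below \<open>e\<close>. Those have
  antidifferences by strong induction; correcting by them and dividing by \<open>Suc e\<close> gives
  \<open>F\<close>.\<close>

lemma power_antidifference: "\<exists>F :: rat poly. \<forall>y. poly F y - poly F (y - 1) = y ^ e"
proof (induction e rule: less_induct)
  case (less e)
  \<comment> \<open>The condition \<open>d < e\<close> moves under the existential, so that
    \<open>choice\<close> yields a function defined for all \<open>d\<close>.\<close>
  then have "\<forall>d. \<exists>F :: rat poly. d < e \<longrightarrow> (\<forall>y. poly F y - poly F (y - 1) = y ^ d)"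
    by blast
  then obtain F :: "nat \<Rightarrow> rat poly" where
    F: "\<forall>d. d < e \<longrightarrow> (\<forall>y. poly (F d) y - poly (F d) (y - 1) = y ^ d)"
    by (rule choice[THEN exE])
  define c :: "nat \<Rightarrow> rat" where "c d = of_nat (Suc e choose d) * (-1) ^ (Suc e - d)" for d
  let ?F = "smult (1 / of_nat (Suc e)) (monom 1 (Suc e) + (\<Sum>d<e. smult (c d) (F d)))"
  have "poly ?F y - poly ?F (y - 1) = y ^ e" for y
  proof -
    have "(y - 1) ^ Suc e = (\<Sum>d\<le>Suc e. c d * y ^ d)"
      using binomial_ring[of y "-1" "Suc e"] by (simp add: c_def mult_ac)
    also have "\<dots> = y ^ Suc e + (c e * y ^ e + (\<Sum>d<e. c d * y ^ d))"
      by (simp add: c_def lessThan_Suc_atMost[symmetric])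
    also have "c e = - of_nat (Suc e)" by (simp add: c_def)
    finally have bin: "y ^ Suc e - (y - 1) ^ Suc e = of_nat (Suc e) * y ^ e - (\<Sum>d<e. c d * y ^ d)"
      by (simp del: power_Suc of_nat_Suc)
    have "poly ?F y - poly ?F (y - 1) = (1 / of_nat (Suc e)) *
        ((y ^ Suc e - (y - 1) ^ Suc e) + (\<Sum>d<e. c d * (poly (F d) y - poly (F d) (y - 1))))"
      by (simp add: poly_monom poly_sum sum_subtractf right_diff_distrib distrib_left
          del: power_Suc of_nat_Suc)
    also have "(\<Sum>d<e. c d * (poly (F d) y - poly (F d) (y - 1))) = (\<Sum>d<e. c d * y ^ d)"
      by (rule sum.cong) (auto simp: F)
    finally show ?thesis by (simp add: bin del: power_Suc of_nat_Suc)
  qed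
  then show ?case by blast
qed

text \<open>In a monomial only the power of \<open>x j\<close> depends on \<open>x j\<close>.
  Replacing this factor by its one-variable antidifference settles monomials, and sums follow by
  linearity.\<close>

lemma polyfun_antidifference:
  assumes "f \<in> polyfun V" "j \<in> V"
  shows "\<exists>F\<in>polyfun V. \<forall>x. F x - F (x(j := x j - 1)) = f x"
  using assms(1)
proof (induction rule: polyfun.induct)
  case (monom m c)
  \<comment> \<open>The variable \<open>j\<close> may be absent from the monomial; its exponent is
    then 0 and still has to be summed.\<close>
  let ?A = "insert j (Poly_Mapping.keys m)"
  let ?e = "Poly_Mapping.lookup m"
  obtain q :: "rat poly" where q: "\<And>y. poly q y - poly q (y - 1) = y ^ ?e j"
    using power_antidifference[of "?e j"] by blast
  let ?r = "\<lambda>x. \<Prod>i\<in>?A - {j}. x i ^ ?e i"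
  define F where "F = (\<lambda>x. c * (poly q (x j) * ?r x))"
  have "F \<in> polyfun V" unfolding F_def
    by (intro polyfun_mult polyfun_const polyfun_poly polyfun_prod polyfun_power polyfun_var)
      (use monom assms(2) in auto)
  moreover have "F x - F (x(j := x j - 1)) = c * mono_eval m x" for x
  proof -
    have "mono_eval m x = x j ^ ?e j * ?r x"
      by (subst mono_eval_superset[of ?A]) (auto simp: prod.insert_remove)
    moreover have "?r (x(j := x j - 1)) = ?r x" by (rule prod.cong) auto
    ultimately show ?thesis
      by (simp only: F_def q[symmetric] fun_upd_same left_diff_distrib right_diff_distrib)
  qed
  ultimately show ?case by blast
next
  case (add f g)
  then obtain F G where FG: "F \<in> polyfun V" "G \<in> polyfun V"
    "\<And>x. F x - F (x(j := x j - 1)) = f x" "\<And>x. G x - G (x(j := x j - 1)) = g x" by blast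
  have "F x + G x - (F (x(j := x j - 1)) + G (x(j := x j - 1))) = f x + g x" for x
    unfolding FG(3)[symmetric] FG(4)[symmetric] by simp
  then show ?case
    by (intro bexI[OF _ polyfun.add[OF FG(1,2)]]) blast
qed

section \<open>Integer functions that are polynomial on weakly increasing arguments\<close>

text \<open>Agreement is demanded only for weakly increasing \<open>x\<close>: a sum over the
  interval from \<open>x j\<close> to \<open>x (Suc j)\<close> follows its closed form as long as
  the endpoints are in order. The polynomial is rational because antidifferences introduce
  denominators.\<close>

definition poly_on :: "nat \<Rightarrow> ((nat \<Rightarrow> int) \<Rightarrow> int) \<Rightarrow> bool" where
  "poly_on n f \<longleftrightarrow> (\<exists>p\<in>polyfun {1..n}. \<forall>x. mono_on {1..n} x \<longrightarrow>
     of_int (f x) = p (\<lambda>i. of_int (x i)))"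

lemma poly_on_diff:
  assumes "poly_on n f" "poly_on n g" shows "poly_on n (\<lambda>x. f x - g x)"
proof -
  obtain p q where "p \<in> polyfun {1..n}" "q \<in> polyfun {1..n}"
    "\<And>x. mono_on {1..n} x \<Longrightarrow> of_int (f x) = p (\<lambda>i. of_int (x i))"
    "\<And>x. mono_on {1..n} x \<Longrightarrow> of_int (g x) = q (\<lambda>i. of_int (x i))"
    using assms unfolding poly_on_def by blast
  then show ?thesis unfolding poly_on_def
    by (intro bexI[of _ "\<lambda>x. p x - q x"]) (simp_all add: polyfun_diff)
qed

lemma poly_on_cong:
  assumes "\<And>x. mono_on {1..n} x \<Longrightarrow> f x = g x" "poly_on n g"
  shows "poly_on n f"
  using assms unfolding poly_on_def by auto

lemma poly_on_mono:
  assumes "poly_on m f" "m \<le> n" shows "poly_on n f"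
proof -
  obtain p where p: "p \<in> polyfun {1..m}"
    "\<And>x. mono_on {1..m} x \<Longrightarrow> of_int (f x) = p (\<lambda>i. of_int (x i))"
    using assms(1) unfolding poly_on_def by blast
  moreover have "p \<in> polyfun {1..n}" by (rule polyfun_mono[OF p(1)]) (use assms(2) in auto)
  moreover have "mono_on {1..m} x" if "mono_on {1..n} x" for x :: "nat \<Rightarrow> int"
    using that by (rule mono_on_subset) (use assms(2) in auto)
  ultimately show ?thesis unfolding poly_on_def by blast
qed

lemma mono_on_upd:
  fixes x :: "nat \<Rightarrow> int"
  assumes "mono_on {1..n} x" "1 \<le> j" "Suc j \<le> n" "x j \<le> v" "v \<le> x (Suc j)"
  shows "mono_on {1..n} (x(j := v))"
proof (rule mono_onI)
  fix r s assume rs: "r \<in> {1..n}" "s \<in> {1..n}" "r \<le> s"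
  have m: "\<And>a b. a \<in> {1..n} \<Longrightarrow> b \<in> {1..n} \<Longrightarrow> a \<le> b \<Longrightarrow> x a \<le> x b"
    using assms(1) by (auto simp: mono_on_def)
  show "(x(j := v)) r \<le> (x(j := v)) s"
  proof (cases "r = j")
    case True
    then show ?thesis using rs m[of "Suc j" s] assms by (cases "s = j") auto
  next
    case False
    then show ?thesis using rs m[of r j] m[of r s] assms by (cases "s = j") auto
  qed
qed

text \<open>The substituted argument is again weakly increasing, so the polynomial of
  \<open>f\<close> is still valid there. This serves the correction terms, where two adjacent row
  entries are both \<open>x (Suc j)\<close>.\<close>

lemma poly_on_shift:
  assumes "poly_on n f" "1 \<le> j" "Suc j \<le> n"
  shows "poly_on n (\<lambda>x. f (x(j := x (Suc j))))"
proof -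
  obtain p where p: "p \<in> polyfun {1..n}"
    "\<And>x. mono_on {1..n} x \<Longrightarrow> of_int (f x) = p (\<lambda>i. of_int (x i))"
    using assms(1) unfolding poly_on_def by blast
  have "(\<lambda>x. p (x(j := x (Suc j)))) \<in> polyfun {1..n}"
    by (rule polyfun_upd[OF p(1) polyfun_var]) (use assms in auto)
  moreover have "of_int (f (x(j := x (Suc j)))) = p ((\<lambda>i. of_int (x i))(j := of_int (x (Suc j))))"
    if x: "mono_on {1..n} x" for x
  proof -
    have "x j \<le> x (Suc j)" using x assms(2,3) by (auto intro: mono_onD[OF x])
    then have "mono_on {1..n} (x(j := x (Suc j)))"
      by (intro mono_on_upd x assms) auto
    moreover have "(\<lambda>i. of_int ((x(j := x (Suc j))) i)) = (\<lambda>i. rat_of_int (x i))(j := of_int (x (Suc j)))"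
      by auto
    ultimately show ?thesis by (metis p(2))
  qed
  ultimately show ?thesis unfolding poly_on_def by (intro bexI[rotated]) auto
qed

text \<open>The sum telescopes. The induction starts with the empty sum at \<open>b = a - 1\<close>,
  where both values of \<open>F\<close> coincide.\<close>

lemma sum_antidifference:
  fixes a b :: int
  assumes F: "\<And>x. F x - F (x(j := x j - 1)) = (f x :: rat)" and "a - 1 \<le> b"
  shows "(\<Sum>v=a..b. f (x(j := of_int v))) = F (x(j := of_int b)) - F (x(j := of_int a - 1))"
  using assms(2)
proof (induction b rule: int_ge_induct)
  case base
  then show ?case by simp
next
  case (step b)
  have "{a..b + 1} = insert (b + 1) {a..b}" using step by auto
  then have "(\<Sum>v=a..b + 1. f (x(j := of_int v)))
      = f (x(j := of_int (b + 1))) + (\<Sum>v=a..b. f (x(j := of_int v)))" by simp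
  also have "f (x(j := of_int (b + 1))) = F (x(j := of_int (b + 1))) - F (x(j := of_int b))"
    using F[of "x(j := of_int (b + 1))"] by simp
  finally show ?case unfolding step.IH by linarith
qed

text \<open>Every \<open>x(j := v)\<close> with \<open>v\<close> in the interval is weakly
  increasing, so \<open>p\<close> represents each summand, and an antidifference of \<open>p\<close>
  in the variable \<open>j\<close> evaluates the sum at the two endpoints.\<close>

lemma poly_on_sum:
  assumes "poly_on n f" "1 \<le> j" "Suc j \<le> n"
  shows "poly_on n (\<lambda>x. \<Sum>v=x j..x (Suc j). f (x(j := v)))"
proof -
  obtain p where p: "p \<in> polyfun {1..n}"
    "\<And>x. mono_on {1..n} x \<Longrightarrow> of_int (f x) = p (\<lambda>i. of_int (x i))"
    using assms(1) unfolding poly_on_def by blast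
  obtain F where F: "F \<in> polyfun {1..n}" "\<And>x. F x - F (x(j := x j - 1)) = p x"
    using polyfun_antidifference[OF p(1), of j] assms by auto
  have "(\<lambda>x. F (x(j := x (Suc j))) - F (x(j := x j - 1))) \<in> polyfun {1..n}"
    by (rule polyfun_diff[OF polyfun_upd[OF F(1) polyfun_var]
          polyfun_upd[OF F(1) polyfun_diff[OF polyfun_var polyfun_const]]]) (use assms in auto)
  moreover have "of_int (\<Sum>v=x j..x (Suc j). f (x(j := v)))
      = F ((\<lambda>i. of_int (x i))(j := of_int (x (Suc j)))) - F ((\<lambda>i. of_int (x i))(j := of_int (x j) - 1))"
    if x: "mono_on {1..n} x" for x
  proof -
    have le: "x j \<le> x (Suc j)" using x assms(2,3) by (auto intro: mono_onD[OF x])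
    have "rat_of_int (f (x(j := v))) = p ((\<lambda>i. of_int (x i))(j := of_int v))"
      if v: "v \<in> {x j..x (Suc j)}" for v
    proof -
      have "mono_on {1..n} (x(j := v))"
        by (intro mono_on_upd x assms) (use v in auto)
      moreover have "(\<lambda>i. of_int ((x(j := v)) i)) = (\<lambda>i. rat_of_int (x i))(j := of_int v)"
        by auto
      ultimately show ?thesis by (metis p(2))
    qed
    then have "of_int (\<Sum>v=x j..x (Suc j). f (x(j := v)))
        = (\<Sum>v=x j..x (Suc j). p ((\<lambda>i. of_int (x i))(j := of_int v)))"
      by simp
    also have "\<dots> = F ((\<lambda>i. of_int (x i))(j := of_int (x (Suc j)))) - F ((\<lambda>i. of_int (x i))(j := of_int (x j) - 1))"
      by (rule sum_antidifference[of F j p]) (use le F(2) in auto)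
    finally show ?thesis .
  qed
  ultimately show ?thesis unfolding poly_on_def by (intro bexI[rotated]) auto
qed

section \<open>Gelfand-Tsetlin patterns\<close>

text \<open>Only cover relations are demanded; \<open>gt_patterns_mono\<close> recovers the whole
  order. Indexing by the upper row avoids truncated subtraction.\<close>

definition gt_patterns :: "nat \<Rightarrow> (nat \<Rightarrow> int) \<Rightarrow> (pos \<Rightarrow> int) set" where
  "gt_patterns n k = {a \<in> GT n \<rightarrow>\<^sub>E UNIV. (\<forall>j\<in>{1..n}. a (n, j) = k j) \<and>
     (\<forall>i j. 1 \<le> j \<and> j \<le> i \<and> i < n \<longrightarrow> a (Suc i, j) \<le> a (i, j) \<and> a (i, j) \<le> a (Suc i, Suc j))}"

definition violations :: "nat \<Rightarrow> (pos \<Rightarrow> int) \<Rightarrow> pos set" where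
  "violations n a = {(i, j) \<in> bad n. a (i, j) = a (i, Suc j)}"

lemma gt_patternsD:
  assumes "a \<in> gt_patterns n k" "1 \<le> j" "j \<le> i" "i < n"
  shows "a (Suc i, j) \<le> a (i, j)" "a (i, j) \<le> a (Suc i, Suc j)"
  using assms unfolding gt_patterns_def by auto

lemma gt_patterns_bottom: "a \<in> gt_patterns n k \<Longrightarrow> 1 \<le> j \<Longrightarrow> j \<le> n \<Longrightarrow> a (n, j) = k j"
  unfolding gt_patterns_def by auto

lemma gt_patterns_undefined: "a \<in> gt_patterns n k \<Longrightarrow> p \<notin> GT n \<Longrightarrow> a p = undefined"
  unfolding gt_patterns_def PiE_def extensional_def by blast

lemma gt_patterns_row_le:
  assumes "a \<in> gt_patterns n k" "1 \<le> j" "j < i" "i < n"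
  shows "a (i, j) \<le> a (i, Suc j)"
  using gt_patternsD[OF assms(1), of j i] gt_patternsD[OF assms(1), of "Suc j" i] assms by auto

text \<open>Interlacing already makes every row above the bottom one weakly increasing, so
  strictness there says exactly that no two neighbours agree.\<close>

lemma monotone_triangles_eq:
  "monotone_triangles n k = {a \<in> gt_patterns n k. violations n a = {}}"
proof (intro set_eqI iffI)
  fix a assume a: "a \<in> monotone_triangles n k"
  have "a (Suc i, j) \<le> a (i, j)" "a (i, j) \<le> a (Suc i, Suc j)"
    if "1 \<le> j" "j \<le> i" "i < n" for i j
  proof -
    have "1 \<le> j \<and> j < Suc i \<and> Suc i \<le> n" using that by auto
    then have "a (Suc i, j) \<le> a (Suc i - 1, j)" using a unfolding monotone_triangles_def by blast
    then show "a (Suc i, j) \<le> a (i, j)" by simp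
    show "a (i, j) \<le> a (Suc i, Suc j)" using a that unfolding monotone_triangles_def by simp
  qed
  moreover have "a (i, j) < a (i, Suc j)" if "(i, j) \<in> bad n" for i j
    using a that unfolding monotone_triangles_def bad_def by auto
  ultimately show "a \<in> {a \<in> gt_patterns n k. violations n a = {}}"
    using a unfolding monotone_triangles_def gt_patterns_def violations_def by fastforce
next
  fix a assume "a \<in> {a \<in> gt_patterns n k. violations n a = {}}"
  then have a: "a \<in> gt_patterns n k" and v: "violations n a = {}" by auto
  have 1: "a (i, j) \<le> a (i - 1, j)" if "1 \<le> j \<and> j < i \<and> i \<le> n" for i j
    using gt_patternsD(1)[OF a, of j "i - 1"] that by (cases i) auto
  have 2: "a (i, j) \<le> a (i + 1, j + 1)" if "1 \<le> j \<and> j \<le> i \<and> i < n" for i j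
    using gt_patternsD(2)[OF a, of j i] that by simp
  have 3: "a (i, j) < a (i, j + 1)" if "1 \<le> j \<and> j < i \<and> i < n" for i j
  proof -
    have "a (i, j) \<noteq> a (i, Suc j)" using v that unfolding violations_def bad_def by auto
    then show ?thesis using gt_patterns_row_le[OF a, of j i] that by simp
  qed
  show "a \<in> monotone_triangles n k"
    using a 1 2 3 unfolding monotone_triangles_def gt_patterns_def by blast
qed

text \<open>Comparable elements are joined by a chain of cover relations: first steps from
  \<open>(i, j)\<close> to \<open>(i - 1, j)\<close>, then steps to \<open>(i + 1, j + 1)\<close>.
  In this order the chain stays inside the triangle, and the induction measure counts the remaining
  steps.\<close>

lemma gt_patterns_mono:
  assumes a: "a \<in> gt_patterns n k" and "p \<in> GT n" "q \<in> GT n" "GT_le p q"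
  shows "a p \<le> a q"
proof -
  obtain r s where q: "q = (r, s)" by (cases q)
  have rs: "1 \<le> s" "s \<le> r" "r \<le> n" using assms(3) by (auto simp: q GT_def)
  have main: "a (i, j) \<le> a (r, s)"
    if "1 \<le> j" "j \<le> i" "i \<le> n" "j \<le> s" "r + j \<le> i + s" for i j
    using that
  proof (induction "(s - j) + (i + s - (r + j))" arbitrary: i j rule: less_induct)
    case less
    consider "r + j < i + s" | "r + j = i + s" "j < s" | "r + j = i + s" "j = s"
      using less.prems by linarith
    then show ?case
    proof cases
      case 1
      then have "j < i" using less.prems rs by linarith
      then have "a (i - 1, j) \<le> a (r, s)"
        by (intro less.hyps) (use less.prems 1 in auto)
      moreover have "a (i, j) \<le> a (i - 1, j)"
        using gt_patternsD(1)[OF a, of j "i - 1"] \<open>j < i\<close> less.prems by (cases i) auto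
      ultimately show ?thesis by simp
    next
      case 2
      then have "a (Suc i, Suc j) \<le> a (r, s)"
        by (intro less.hyps) (use less.prems rs in auto)
      moreover have "a (i, j) \<le> a (Suc i, Suc j)"
        using gt_patternsD(2)[OF a, of j i] 2 less.prems rs by simp
      ultimately show ?thesis by simp
    next
      case 3
      then show ?thesis by simp
    qed
  qed
  obtain i j where p: "p = (i, j)" by (cases p)
  show ?thesis unfolding p q
    by (rule main) (use assms(2,4) in \<open>auto simp: p q GT_def GT_le_def\<close>)
qed

lemma finite_GT: "finite (GT n)"
  by (rule finite_subset[of _ "{..n} \<times> {..n}"]) (auto simp: GT_def)

lemma finite_bad: "finite (bad n)"
  by (rule finite_subset[of _ "{..n} \<times> {..n}"]) (auto simp: bad_def)

text \<open>The entry at \<open>(i, j)\<close> lies between the bottom entries at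
  \<open>(n, j)\<close> and \<open>(n, n + j - i)\<close>, so the extreme values of the bottom row
  bound every entry.\<close>

lemma finite_gt_patterns: "finite (gt_patterns n k)"
proof (rule finite_subset)
  show "gt_patterns n k \<subseteq> GT n \<rightarrow>\<^sub>E {Min (k ` {1..n})..Max (k ` {1..n})}"
  proof
    fix a assume a: "a \<in> gt_patterns n k"
    have "a (i, j) \<in> {Min (k ` {1..n})..Max (k ` {1..n})}" if ij: "(i, j) \<in> GT n" for i j
    proof -
      have b: "1 \<le> j" "j \<le> i" "i \<le> n" using ij by (auto simp: GT_def)
      have "a (n, j) \<le> a (i, j)" "a (i, j) \<le> a (n, n + j - i)"
        by (rule gt_patterns_mono[OF a]; use b in \<open>auto simp: GT_def GT_le_def\<close>)+
      moreover have "a (n, j) = k j" "a (n, n + j - i) = k (n + j - i)"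
        by (rule gt_patterns_bottom[OF a]; use b in auto)+
      moreover have "Min (k ` {1..n}) \<le> k j" by (rule Min_le) (use b in auto)
      moreover have "k (n + j - i) \<le> Max (k ` {1..n})"
        by (rule Max_ge) (use b in \<open>auto intro!: imageI\<close>)
      ultimately show ?thesis by simp
    qed
    then show "a \<in> GT n \<rightarrow>\<^sub>E {Min (k ` {1..n})..Max (k ` {1..n})}"
      using a unfolding gt_patterns_def by (auto simp: PiE_iff)
  qed
  show "finite (GT n \<rightarrow>\<^sub>E {Min (k ` {1..n})..Max (k ` {1..n})})"
    by (intro finite_PiE finite_GT) auto
qed

lemma gt_patterns_squeeze:
  assumes "a \<in> gt_patterns n k" "1 \<le> j" "j \<le> i" "i < n" "a (Suc i, j) = a (Suc i, Suc j)"
  shows "a (i, j) = a (Suc i, j)"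
  using gt_patternsD[OF assms(1-4)] assms(5) by simp

text \<open>Three equal neighbours squeeze the two entries that interlace with them in the row
  above.\<close>

lemma violations_adjacent:
  assumes a: "a \<in> gt_patterns n k" and "(i, j) \<in> violations n a" "(i, Suc j) \<in> violations n a"
  shows "(i - 1, j) \<in> violations n a"
proof (cases i)
  case 0
  then show ?thesis using assms by (auto simp: violations_def bad_def)
next
  case (Suc h)
  have b: "1 \<le> j" "Suc j \<le> h" "Suc h < n" "a (Suc h, j) = a (Suc h, Suc j)"
    "a (Suc h, Suc j) = a (Suc h, Suc (Suc j))"
    using assms by (auto simp: violations_def bad_def Suc)
  have "a (h, j) = a (Suc h, j)" "a (h, Suc j) = a (Suc h, Suc j)"
    by (rule gt_patterns_squeeze[OF a]; use b in simp)+
  then show ?thesis using b by (simp add: violations_def bad_def Suc)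
qed

section \<open>Essential diamond posets as sets of positions\<close>

definition ess_sets :: "nat \<Rightarrow> pos set set" where
  "ess_sets n = {S. S \<subseteq> bad n \<and> (\<forall>i j. \<not> ((i, j) \<in> S \<and> (i, Suc j) \<in> S))}"

lemma finite_ess_sets: "finite (ess_sets n)"
  by (rule finite_subset[of _ "Pow (bad n)"]) (auto simp: ess_sets_def finite_bad)

text \<open>An edge of a diamond lies in at most one other diamond, and the two other diamonds that can
  contain the edges of the diamond \<open>(i, j)\<close> through \<open>(i - 1, j)\<close> are horizontal neighbours.\<close>

lemma I_set_ess:
  assumes "S \<in> ess_sets n"
  shows "I_set n (\<Union>p\<in>S. diamond p) = S"
proof
  show "S \<subseteq> I_set n (\<Union>p\<in>S. diamond p)"
    using assms by (auto simp: I_set_def ess_sets_def)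
  show "I_set n (\<Union>p\<in>S. diamond p) \<subseteq> S"
  proof clarify
    fix i j assume "(i, j) \<in> I_set n (\<Union>p\<in>S. diamond p)"
    then have b: "1 \<le> j" "j < i" and d: "diamond (i, j) \<subseteq> (\<Union>p\<in>S. diamond p)"
      by (auto simp: I_set_def bad_def)
    have S: "1 \<le> s \<and> s < r" if "(r, s) \<in> S" for r s
      using assms that by (auto simp: ess_sets_def bad_def)
    from d have "((i, j), (i - 1, j)) \<in> (\<Union>p\<in>S. diamond p)" "((i - 1, j), (i, j + 1)) \<in> (\<Union>p\<in>S. diamond p)"
      by auto
    then obtain p q where "p \<in> S" "((i, j), (i - 1, j)) \<in> diamond p"
      "q \<in> S" "((i - 1, j), (i, j + 1)) \<in> diamond q" by blast
    then obtain r s t u where pq: "(r, s) \<in> S" "((i, j), (i - 1, j)) \<in> diamond (r, s)"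
      "(t, u) \<in> S" "((i - 1, j), (i, j + 1)) \<in> diamond (t, u)"
      by (metis surj_pair)
    have "(r, s) = (i, j) \<or> (r, Suc s) = (i - 1, j)"
      using pq(2) S[OF pq(1)] b by auto
    moreover have "(t, u) = (i, j) \<or> (t, u) = (i - 1, j)"
      using pq(4) S[OF pq(3)] b by auto
    moreover have "\<not> ((i - 1, s) \<in> S \<and> (i - 1, Suc s) \<in> S)" for s
      using assms by (auto simp: ess_sets_def)
    ultimately show "(i, j) \<in> S" using pq(1,3) by auto
  qed
qed

text \<open>If \<open>S\<close> generates \<open>G\<close>, then \<open>S\<close> is contained in
  \<open>I_set n G\<close> and inherits the absence of horizontal neighbours. Conversely
  \<open>I_set_ess\<close> shows that \<open>G\<close> contains no diamonds outside
  \<open>S\<close>, hence no two horizontally adjacent ones, and so it meets closedness.\<close>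

lemma Q_ess_eq: "Q_ess n = (\<lambda>S. \<Union>p\<in>S. diamond p) ` ess_sets n"
proof (intro set_eqI iffI)
  fix G assume G: "G \<in> Q_ess n"
  then obtain S where S: "S \<subseteq> bad n" "G = (\<Union>p\<in>S. diamond p)"
    by (auto simp: Q_ess_def closed_diamond_poset_def diamond_poset_def)
  have "S \<subseteq> I_set n G" using S by (auto simp: I_set_def)
  moreover have "\<not> ((i, j) \<in> I_set n G \<and> (i, Suc j) \<in> I_set n G)" for i j
    using G by (auto simp: Q_ess_def)
  ultimately have "S \<in> ess_sets n" using S(1) unfolding ess_sets_def by blast
  then show "G \<in> (\<lambda>S. \<Union>p\<in>S. diamond p) ` ess_sets n" using S(2) by blast
next
  fix G assume "G \<in> (\<lambda>S. \<Union>p\<in>S. diamond p) ` ess_sets n"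
  then obtain S where S: "S \<in> ess_sets n" "G = (\<Union>p\<in>S. diamond p)" by blast
  have I: "I_set n G = S" using I_set_ess[OF S(1)] S(2) by simp
  have ind: "\<not> ((i, j) \<in> I_set n G \<and> (i, j + 1) \<in> I_set n G)" for i j
    using S(1) by (simp add: I ess_sets_def)
  then have "\<not> ((i, j) \<in> bad n \<and> (i, j + 1) \<in> bad n \<and> diamond (i, j) \<union> diamond (i, j + 1) \<subseteq> G)"
    for i j unfolding I_set_def by blast
  moreover have "diamond_poset n G"
    using S by (auto simp: diamond_poset_def ess_sets_def)
  ultimately show "G \<in> Q_ess n" using ind
    unfolding Q_ess_def closed_diamond_poset_def by blast
qed

lemma inj_on_ess_sets: "inj_on (\<lambda>S. \<Union>p\<in>S. diamond p) (ess_sets n)"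
  by (rule inj_on_inverseI[of _ "I_set n"]) (rule I_set_ess)

section \<open>Order preserving maps on the quotient poset\<close>

lemma connected_rel_equiv: "equiv UNIV (connected_rel G)"
  unfolding connected_rel_def
  by (intro equivI refl_rtrancl sym_rtrancl trans_rtrancl) (auto simp: sym_def)

lemma connected_rel_const:
  assumes "(p, q) \<in> connected_rel G" "\<And>r s. (r, s) \<in> G \<Longrightarrow> h r = h s"
  shows "h p = h q"
  using assms(1) unfolding connected_rel_def
  by (induction rule: rtrancl_induct) (auto dest: assms(2))

lemma diamond_subset_GT: "p \<in> bad n \<Longrightarrow> diamond p \<subseteq> GT n \<times> GT n"
  by (cases p) (auto simp: bad_def GT_def)

text \<open>The top and bottom corners of a diamond take values between those of its left and right
  corners, which a violation makes equal.\<close>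

lemma violations_diamond:
  assumes a: "a \<in> gt_patterns n k" and "p \<in> violations n a" "(r, s) \<in> diamond p"
  shows "a r = a s"
proof -
  obtain h j where p: "p = (Suc h, j)" and b: "1 \<le> j" "j \<le> h" "Suc h < n"
    "a (Suc h, j) = a (Suc h, Suc j)"
    using assms(2) by (cases p; cases "fst p") (auto simp: violations_def bad_def)
  have "a (h, j) = a (Suc h, j)" by (rule gt_patterns_squeeze[OF a]) (use b in auto)
  moreover have "a (Suc h, j) \<le> a (Suc (Suc h), Suc j)" "a (Suc (Suc h), Suc j) \<le> a (Suc h, Suc j)"
    using gt_patternsD(2)[OF a, of j "Suc h"] gt_patternsD(1)[OF a, of "Suc j" "Suc h"] b by auto
  ultimately show ?thesis using assms(3) b(4) by (auto simp: p)
qed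

text \<open>Pulling back along the projection to the quotient is a bijection. A pulled-back map is
  constant on components, hence violated on \<open>S\<close>; a pattern violated on \<open>S\<close>
  is constant on each diamond of \<open>S\<close>, hence on components, and descends.\<close>

lemma Omega_eq:
  assumes S: "S \<subseteq> bad n"
  shows "Omega n (\<Union>p\<in>S. diamond p) k = card {a \<in> gt_patterns n k. S \<subseteq> violations n a}"
proof -
  define G where "G = (\<Union>p\<in>S. diamond p)"
  define R where "R = connected_rel G"
  define F where "F = {f \<in> GT_quot n G \<rightarrow>\<^sub>E (UNIV :: int set).
     (\<forall>(C, D) \<in> quot_order n G. f C \<le> f D) \<and>
     (\<forall>C \<in> bottom_quot n G. \<forall>j. (n, j) \<in> C \<inter> bottom n \<longrightarrow> f C = k j)}"
  define A where "A = {a \<in> gt_patterns n k. S \<subseteq> violations n a}"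
  define \<Phi> where "\<Phi> f = restrict (\<lambda>p. f (R `` {p})) (GT n)" for f :: "pos set \<Rightarrow> int"
  have eq: "equiv UNIV R" unfolding R_def by (rule connected_rel_equiv)
  have cls: "R `` {p} = R `` {q}" if "(p, q) \<in> R" for p q
    using equiv_class_eq[OF eq that] .
  have self: "p \<in> R `` {p}" for p using equiv_class_self[OF eq] by simp
  have quot: "R `` {p} \<in> GT_quot n G" if "p \<in> GT n" for p
    unfolding GT_quot_def R_def[symmetric] using that by (rule quotientI)
  have quotE: "\<exists>p\<in>GT n. C = R `` {p}" if "C \<in> GT_quot n G" for C
    using that unfolding GT_quot_def R_def[symmetric] by (auto elim: quotientE)
  have GGT: "G \<subseteq> GT n \<times> GT n" using diamond_subset_GT S unfolding G_def by blast
  \<comment> \<open>Membership in \<open>GT n\<close> is itself a function that is constant along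
    the edges of \<open>G\<close>, so a component meeting \<open>GT n\<close> stays inside
    it.\<close>
  have GTcl: "q \<in> GT n" if "(p, q) \<in> R" "p \<in> GT n" for p q
    using connected_rel_const[of p q G "\<lambda>p. p \<in> GT n"] that GGT unfolding R_def by blast
  have img: "\<Phi> f \<in> A" if f: "f \<in> F" for f
  proof -
    have mono: "\<Phi> f p \<le> \<Phi> f q" if "p \<in> GT n" "q \<in> GT n" "GT_le p q" for p q
    proof -
      have "(R `` {p}, R `` {q}) \<in> quot_order n G"
        unfolding quot_order_def using that quot self by blast
      then show ?thesis using f that unfolding F_def \<Phi>_def by auto
    qed
    have "\<Phi> f (n, j) = k j" if "j \<in> {1..n}" for j
    proof -
      have "R `` {(n, j)} \<in> bottom_quot n G" unfolding bottom_quot_def R_def[symmetric]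
        by (rule quotientI) (use that in \<open>auto simp: bottom_def\<close>)
      moreover have "(n, j) \<in> R `` {(n, j)} \<inter> bottom n"
        using self that by (auto simp: bottom_def)
      ultimately have "f (R `` {(n, j)}) = k j" using f unfolding F_def by blast
      then show ?thesis using that by (simp add: \<Phi>_def GT_def)
    qed
    moreover have "\<Phi> f (Suc i, j) \<le> \<Phi> f (i, j)" "\<Phi> f (i, j) \<le> \<Phi> f (Suc i, Suc j)"
      if "1 \<le> j" "j \<le> i" "i < n" for i j
      by (rule mono; use that in \<open>auto simp: GT_def GT_le_def\<close>)+
    ultimately have "\<Phi> f \<in> gt_patterns n k"
      unfolding gt_patterns_def by (auto simp: \<Phi>_def)
    moreover have "(i, j) \<in> violations n (\<Phi> f)" if "(i, j) \<in> S" for i j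
    proof -
      have b: "(i, j) \<in> bad n" using that S by blast
      \<comment> \<open>The path over the top corner of the diamond joins its left and right
        corners.\<close>
      have "((i, j), (i - 1, j)) \<in> G" "((i - 1, j), (i, Suc j)) \<in> G"
        using that unfolding G_def by force+
      then have "((i, j), (i, Suc j)) \<in> R" unfolding R_def connected_rel_def
        by (meson UnI1 r_into_rtrancl rtrancl_trans)
      then have "\<Phi> f (i, j) = \<Phi> f (i, Suc j)"
        using b cls by (auto simp: \<Phi>_def bad_def GT_def)
      then show ?thesis using b by (simp add: violations_def)
    qed
    ultimately show ?thesis unfolding A_def by auto
  qed
  have inj: "inj_on \<Phi> F"
  proof (rule inj_onI)
    fix f g assume fg: "f \<in> F" "g \<in> F" "\<Phi> f = \<Phi> g"
    show "f = g"
    proof (rule PiE_ext)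
      show "f \<in> GT_quot n G \<rightarrow>\<^sub>E UNIV" "g \<in> GT_quot n G \<rightarrow>\<^sub>E UNIV"
        using fg by (auto simp: F_def)
      fix C assume "C \<in> GT_quot n G"
      then obtain p where p: "p \<in> GT n" "C = R `` {p}" using quotE by blast
      have "\<Phi> f p = \<Phi> g p" using fg by simp
      then show "f C = g C" using p by (simp add: \<Phi>_def)
    qed
  qed
  have surj: "a \<in> \<Phi> ` F" if "a \<in> A" for a
  proof -
    have a: "a \<in> gt_patterns n k" and v: "S \<subseteq> violations n a"
      using that by (auto simp: A_def)
    have const: "a p = a q" if "(p, q) \<in> R" for p q
      by (rule connected_rel_const[OF that[unfolded R_def]])
        (use v violations_diamond[OF a] in \<open>auto simp: G_def\<close>)
    \<comment> \<open>The choice of representative is immaterial because \<open>a\<close> is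
      constant on components.\<close>
    define f where "f = restrict (\<lambda>C. a (SOME p. p \<in> C)) (GT_quot n G)"
    have f: "f (R `` {p}) = a p" if "p \<in> GT n" for p
    proof -
      have "(SOME q. q \<in> R `` {p}) \<in> R `` {p}" using self by (rule someI)
      then show ?thesis using const[of p] quot[OF that] by (simp add: f_def)
    qed
    \<comment> \<open>The quotient order is a transitive closure, so it suffices to compare classes
      with comparable members; by \<open>GTcl\<close> these members lie in \<open>GT n\<close>,
      where \<open>a\<close> is monotone.\<close>
    have fle: "f C \<le> f D" if "(C, D) \<in> quot_order n G" for C D
      using that unfolding quot_order_def
    proof (induction rule: trancl_induct)
      case (base D)
      then obtain p q where pq: "p \<in> C" "q \<in> D" "GT_le p q" by blast
      obtain p' q' where "C = R `` {p'}" "D = R `` {q'}" "p' \<in> GT n" "q' \<in> GT n"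
        using base quotE by blast
      then have "C = R `` {p}" "D = R `` {q}" "p \<in> GT n" "q \<in> GT n"
        using pq cls GTcl by auto
      then show ?case using f gt_patterns_mono[OF a _ _ pq(3)] by simp
    next
      case (step D E)
      obtain p q where pq: "p \<in> D" "q \<in> E" "GT_le p q" using step by blast
      obtain p' q' where "D = R `` {p'}" "E = R `` {q'}" "p' \<in> GT n" "q' \<in> GT n"
        using step quotE by blast
      then have "D = R `` {p}" "E = R `` {q}" "p \<in> GT n" "q \<in> GT n"
        using pq cls GTcl by auto
      then have "f D \<le> f E" using f gt_patterns_mono[OF a _ _ pq(3)] by simp
      then show ?case using step.IH by simp
    qed
    have "f C = k j" if C: "C \<in> bottom_quot n G" "(n, j) \<in> C \<inter> bottom n" for C j
    proof -
      obtain p where "C = R `` {p}"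
        using C(1) unfolding bottom_quot_def R_def[symmetric] by (auto elim: quotientE)
      then have "C = R `` {(n, j)}" using C(2) cls by auto
      moreover have "(n, j) \<in> GT n" "1 \<le> j" "j \<le> n" using C(2) by (auto simp: bottom_def GT_def)
      ultimately show ?thesis using f gt_patterns_bottom[OF a] by simp
    qed
    moreover have "f \<in> GT_quot n G \<rightarrow>\<^sub>E UNIV" by (simp add: f_def)
    ultimately have "f \<in> F" using fle unfolding F_def by blast
    moreover have "\<Phi> f = a"
    proof
      fix p show "\<Phi> f p = a p"
        using f a by (cases p; cases "p \<in> GT n") (auto simp: \<Phi>_def gt_patterns_def PiE_def extensional_def)
    qed
    ultimately show ?thesis by blast
  qed
  have "\<Phi> ` F = A" using img surj by blast
  then have "card F = card A" using card_image[OF inj] by simp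
  then show ?thesis by (simp add: Omega_def F_def A_def G_def)
qed

section \<open>Cancellation at a topmost violation\<close>

lemma alternating_ess_sum:
  assumes a: "a \<in> gt_patterns n k"
  shows "(\<Sum>S\<in>{S \<in> ess_sets n. S \<subseteq> violations n a}. (-1 :: int) ^ card S)
    = (if violations n a = {} then 1 else 0)"
proof (cases "violations n a = {}")
  case True
  then have "{S \<in> ess_sets n. S \<subseteq> violations n a} = {{}}" by (auto simp: ess_sets_def)
  then show ?thesis using True by simp
next
  case False
  define B where "B = violations n a"
  \<comment> \<open>Rows are numbered downwards from the apex, so the least index is the topmost
    violated row.\<close>
  define i where "i = (LEAST i. \<exists>j. (i, j) \<in> B)"
  have "\<exists>i j. (i, j) \<in> B" using False by (auto simp: B_def)
  then have "\<exists>j. (i, j) \<in> B" unfolding i_def by (rule LeastI_ex)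
  then obtain j where ij: "(i, j) \<in> B" by blast
  have Bbad: "B \<subseteq> bad n" by (auto simp: B_def violations_def)
  have "i \<noteq> 0" using ij Bbad by (auto simp: bad_def)
  have alone: "\<not> ((i, s) \<in> B \<and> (i, Suc s) \<in> B)" for s
  proof
    assume "(i, s) \<in> B \<and> (i, Suc s) \<in> B"
    then have "(i - 1, s) \<in> B" using violations_adjacent[OF a] by (auto simp: B_def)
    then have "i \<le> i - 1" unfolding i_def by (intro Least_le) blast
    then show False using \<open>i \<noteq> 0\<close> by simp
  qed
  define T where "T = {S \<in> ess_sets n. S \<subseteq> B}"
  \<comment> \<open>Toggling the chosen violation is an involution on \<open>T\<close> that changes
    the parity of the cardinality; \<open>alone\<close> ensures that an insertion creates no
    horizontal neighbours.\<close>
  define t where "t S = (if (i, j) \<in> S then S - {(i, j)} else insert (i, j) S)" for S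
  have T: "t S \<in> T" if "S \<in> T" for S
  proof (cases "(i, j) \<in> S")
    case True
    then show ?thesis using that by (auto simp: T_def t_def ess_sets_def)
  next
    case False
    have SB: "S \<subseteq> B" and ind: "\<And>r s. \<not> ((r, s) \<in> S \<and> (r, Suc s) \<in> S)"
      using that by (auto simp: T_def ess_sets_def)
    have "\<not> ((r, s) \<in> insert (i, j) S \<and> (r, Suc s) \<in> insert (i, j) S)" for r s
      using alone[of s] ind[of r s] ij SB by auto
    moreover have "insert (i, j) S \<subseteq> B" using ij SB by simp
    ultimately have "insert (i, j) S \<in> ess_sets n" using Bbad unfolding ess_sets_def by blast
    then show ?thesis using False ij SB by (simp add: T_def t_def)
  qed
  have tt: "t (t S) = S" for S by (auto simp: t_def)
  have sgn: "(-1 :: int) ^ card (t S) = - ((-1) ^ card S)" if "S \<in> T" for S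
  proof -
    have fin: "finite S"
      using that finite_subset[OF _ finite_bad] by (auto simp: T_def ess_sets_def)
    show ?thesis
    proof (cases "(i, j) \<in> S")
      case True
      have "card S = Suc (card (t S))"
        using card.remove[OF fin True] True by (simp only: t_def if_True)
      then show ?thesis by simp
    next
      case False
      then show ?thesis using fin by (simp add: t_def)
    qed
  qed
  \<comment> \<open>Reindexing along \<open>t\<close> identifies the sum with its own
    negative.\<close>
  have "(\<Sum>S\<in>T. (-1 :: int) ^ card S) = (\<Sum>S\<in>T. - ((-1) ^ card S))"
  proof (rule sum.reindex_bij_witness[of T t t])
    fix S assume S: "S \<in> T"
    show "t (t S) = S" "t (t S) = S" by (rule tt)+
    show "t S \<in> T" "t S \<in> T" using S by (rule T)+
    show "- ((-1) ^ card (t S)) = (-1 :: int) ^ card S" by (simp add: sgn[OF S])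
  qed
  then have "(\<Sum>S\<in>T. (-1 :: int) ^ card S) = 0" by (simp add: sum_negf)
  then show ?thesis using False by (simp add: T_def B_def)
qed

text \<open>Both sides count, with signs, pairs of a pattern and an essential set inside its
  violations. Summing over the sets first leaves 1 for a monotone triangle and 0 for any other
  pattern.\<close>

lemma alpha_eq_sum_Omega:
  "int (alpha n k) = (\<Sum>G \<in> Q_ess n. (-1) ^ card (I_set n G) * int (Omega n G k))"
proof -
  have "(\<Sum>G \<in> Q_ess n. (-1) ^ card (I_set n G) * int (Omega n G k))
      = (\<Sum>S \<in> ess_sets n. (-1) ^ card S * int (card {a \<in> gt_patterns n k. S \<subseteq> violations n a}))"
    unfolding Q_ess_eq sum.reindex[OF inj_on_ess_sets] o_def
    by (rule sum.cong) (auto simp: I_set_ess Omega_eq ess_sets_def)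
  also have "\<dots> = (\<Sum>S \<in> ess_sets n. \<Sum>a \<in> {a \<in> gt_patterns n k. S \<subseteq> violations n a}. (-1) ^ card S)"
    by (simp add: mult.commute)
  also have "\<dots> = (\<Sum>S \<in> ess_sets n. \<Sum>a \<in> gt_patterns n k.
      if S \<subseteq> violations n a then (-1) ^ card S else 0)"
    by (rule sum.cong[OF refl], rule sum.inter_filter[OF finite_gt_patterns])
  also have "\<dots> = (\<Sum>a \<in> gt_patterns n k. \<Sum>S \<in> ess_sets n.
      if S \<subseteq> violations n a then (-1) ^ card S else 0)"
    by (rule sum.swap)
  also have "\<dots> = (\<Sum>a \<in> gt_patterns n k. if violations n a = {} then 1 else 0)"
    by (rule sum.cong) (simp_all add: sum.inter_filter[symmetric] finite_ess_sets alternating_ess_sum)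
  also have "\<dots> = int (alpha n k)"
    by (simp add: alpha_def monotone_triangles_eq sum.inter_filter[symmetric] finite_gt_patterns)
  finally show ?thesis by simp
qed

text \<open>The argument of \<open>violations_adjacent\<close>, repeated for the bottom row, which
  lies outside \<open>bad n\<close>: the three equal entries force a violation in the row above
  it.\<close>

lemma alpha_triple:
  assumes "1 \<le> j" "j + 2 \<le> n" "k j = k (j + 1)" "k (j + 1) = k (j + 2)"
  shows "alpha n k = 0"
proof -
  have "violations n a \<noteq> {}" if a: "a \<in> gt_patterns n k" for a
  proof -
    obtain h where h: "n = Suc h" using assms(2) by (cases n) auto
    have b: "a (n, j) = k j" "a (n, Suc j) = k (Suc j)" "a (n, Suc (Suc j)) = k (Suc (Suc j))"
      by (rule gt_patterns_bottom[OF a]; use assms in simp)+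
    have "a (h, j) = a (Suc h, j)" "a (h, Suc j) = a (Suc h, Suc j)"
      by (rule gt_patterns_squeeze[OF a]; use assms b in \<open>simp add: h\<close>)+
    then have "(h, j) \<in> violations n a" using assms b by (simp add: violations_def bad_def h)
    then show ?thesis by blast
  qed
  then have "monotone_triangles n k = {}" by (auto simp: monotone_triangles_eq)
  then show ?thesis by (simp add: alpha_def)
qed

section \<open>Row-by-row recursion\<close>

text \<open>For \<open>j = 1\<close> these are the strict rows that fit above the bottom row
  \<open>x\<close>. For larger \<open>j\<close> the entries before \<open>j\<close> are already
  chosen and stored in \<open>x\<close> itself; strictness between the positions
  \<open>j - 1\<close> and \<open>j\<close> is not imposed.\<close>

definition rows :: "nat \<Rightarrow> nat \<Rightarrow> (nat \<Rightarrow> int) \<Rightarrow> (nat \<Rightarrow> int) set" where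
  "rows m j x = {l. (\<forall>i. i \<notin> {j..m} \<longrightarrow> l i = x i) \<and>
     (\<forall>i\<in>{j..m}. x i \<le> l i \<and> l i \<le> x (Suc i)) \<and> (\<forall>i\<in>{j..<m}. l i < l (Suc i))}"

lemma finite_rows: "finite (rows m j x)"
proof (rule finite_subset)
  show "rows m j x \<subseteq> (\<lambda>g i. if i \<in> {j..m} then g i else x i) ` (Pi\<^sub>E {j..m} (\<lambda>i. {x i..x (Suc i)}))"
  proof
    fix l assume l: "l \<in> rows m j x"
    show "l \<in> (\<lambda>g i. if i \<in> {j..m} then g i else x i) ` (Pi\<^sub>E {j..m} (\<lambda>i. {x i..x (Suc i)}))"
      by (rule image_eqI[of _ _ "restrict l {j..m}"]) (use l in \<open>auto simp: rows_def fun_eq_iff\<close>)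
  qed
  show "finite ((\<lambda>g i. if i \<in> {j..m} then g i else x i) ` (Pi\<^sub>E {j..m} (\<lambda>i. {x i..x (Suc i)})))"
    by (intro finite_imageI finite_PiE) auto
qed

lemma rows_empty: "rows m (Suc m) x = {x}"
  by (auto simp: rows_def fun_eq_iff)

lemma agree_fix:
  assumes "j \<le> m"
  shows "(\<forall>i. i \<notin> {Suc j..m} \<longrightarrow> l i = (x(j := v)) i) \<longleftrightarrow>
    (\<forall>i. i \<notin> {j..m} \<longrightarrow> l i = x i) \<and> l j = v" (is "?L \<longleftrightarrow> ?R")
proof
  assume h: ?L
  have "l j = v" using h[rule_format, of j] by simp
  moreover have "l i = x i" if "i \<notin> {j..m}" for i
  proof -
    have "i \<noteq> j" "i \<notin> {Suc j..m}" using that assms by auto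
    then show ?thesis using h by simp
  qed
  ultimately show ?R by blast
next
  assume h: ?R
  have "l i = (x(j := v)) i" if "i \<notin> {Suc j..m}" for i
  proof (cases "i = j")
    case True
    then show ?thesis using h by simp
  next
    case False
    then have "i \<notin> {j..m}" using that by auto
    then show ?thesis using h False by simp
  qed
  then show ?L by blast
qed

text \<open>The bounds on the entries after \<open>j\<close> involve \<open>x\<close> only from
  \<open>Suc j\<close> on, so storing a chosen entry in position \<open>j\<close> leaves them
  unchanged.\<close>

lemma rows_fix:
  assumes "j \<le> m"
  shows "rows m (Suc j) (x(j := v)) = {l. (\<forall>i. i \<notin> {j..m} \<longrightarrow> l i = x i) \<and> l j = v \<and>
     (\<forall>i\<in>{Suc j..m}. x i \<le> l i \<and> l i \<le> x (Suc i)) \<and> (\<forall>i\<in>{Suc j..<m}. l i < l (Suc i))}"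
proof -
  have "(\<forall>i\<in>{Suc j..m}. (x(j := v)) i \<le> l i \<and> l i \<le> (x(j := v)) (Suc i)) \<longleftrightarrow>
      (\<forall>i\<in>{Suc j..m}. x i \<le> l i \<and> l i \<le> x (Suc i))" for l
    by (rule ball_cong) auto
  then show ?thesis unfolding rows_def agree_fix[OF assms] by simp
qed

lemma ball_Icc_split: "j \<le> m \<Longrightarrow> (\<forall>i\<in>{j..m}. P i) \<longleftrightarrow> P j \<and> (\<forall>i\<in>{Suc j..m}. P i)"
  for j m :: nat
  unfolding atLeastAtMost_insertL[symmetric] by blast

lemma ball_Ico_split: "j < m \<Longrightarrow> (\<forall>i\<in>{j..<m}. P i) \<longleftrightarrow> P j \<and> (\<forall>i\<in>{Suc j..<m}. P i)"
  for j m :: nat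
  by (metis atLeastLessThan_iff Suc_leD Suc_leI le_neq_implies_less order_refl)

text \<open>The first sum also counts the rows with \<open>l j = l (j + 1)\<close>, where both entries are
  \<open>x (j + 1)\<close>. Those are counted by the second sum, which does not ask for
  \<open>l (j + 1) < l (j + 2)\<close>; but where this fails, the summand is \<open>0\<close>.\<close>

lemma sum_rows_rec:
  fixes f :: "(nat \<Rightarrow> int) \<Rightarrow> int"
  assumes triple: "\<And>l i. 1 \<le> i \<Longrightarrow> i + 2 \<le> m \<Longrightarrow> l i = l (i + 1) \<Longrightarrow> l (i + 1) = l (i + 2) \<Longrightarrow> f l = 0"
    and x: "mono_on {1..Suc m} x" and j: "1 \<le> j" "j \<le> m"
  shows "(\<Sum>l\<in>rows m j x. f l) = (\<Sum>v=x j..x (Suc j). \<Sum>l\<in>rows m (Suc j) (x(j := v)). f l)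
    - (if j = m then 0 else \<Sum>l\<in>rows m (j + 2) (x(j := x (Suc j))). f l)"
proof -
  \<comment> \<open>\<open>W\<close> drops only the condition \<open>l j < l (Suc j)\<close>, so
    that \<open>l j\<close> ranges freely over its interval.\<close>
  define W where "W = {l. (\<forall>i. i \<notin> {j..m} \<longrightarrow> l i = x i) \<and>
     (\<forall>i\<in>{j..m}. x i \<le> l i \<and> l i \<le> x (Suc i)) \<and> (\<forall>i\<in>{Suc j..<m}. l i < l (Suc i))}"
  have W: "W = (\<Union>v\<in>{x j..x (Suc j)}. rows m (Suc j) (x(j := v)))"
    unfolding W_def rows_fix[OF j(2)] ball_Icc_split[OF j(2)] by auto
  have "finite W" unfolding W by (intro finite_UN_I finite_rows) auto
  have sumW: "(\<Sum>l\<in>W. f l) = (\<Sum>v=x j..x (Suc j). \<Sum>l\<in>rows m (Suc j) (x(j := v)). f l)"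
    unfolding W
  proof (rule sum.UNION_disjoint)
    show "\<forall>v\<in>{x j..x (Suc j)}. finite (rows m (Suc j) (x(j := v)))" by (simp add: finite_rows)
    show "\<forall>v\<in>{x j..x (Suc j)}. \<forall>w\<in>{x j..x (Suc j)}. v \<noteq> w \<longrightarrow>
        rows m (Suc j) (x(j := v)) \<inter> rows m (Suc j) (x(j := w)) = {}"
      by (auto simp: rows_fix[OF j(2)])
  qed simp
  have xle: "x r \<le> x s" if "1 \<le> r" "r \<le> s" "s \<le> Suc m" for r s
    using that by (intro mono_onD[OF x]) auto
  show ?thesis
  proof (cases "j = m")
    case True
    then have "W = rows m j x" by (auto simp: W_def rows_def)
    then show ?thesis using sumW True by simp
  next
    case False
    with j have jm: "j < m" by simp
    have strict: "rows m j x = {l \<in> W. l j < l (Suc j)}"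
      unfolding W_def rows_def ball_Ico_split[OF jm] by blast
    define E where "E = rows m (j + 2) (x(j := x (Suc j)))"
    have E: "E = {l. (\<forall>i. i \<notin> {j..m} \<longrightarrow> l i = x i) \<and> l j = x (Suc j) \<and> l (Suc j) = x (Suc j) \<and>
     (\<forall>i\<in>{j + 2..m}. x i \<le> l i \<and> l i \<le> x (Suc i)) \<and> (\<forall>i\<in>{j + 2..<m}. l i < l (Suc i))}"
    proof -
      \<comment> \<open>Overwriting position \<open>Suc j\<close> with the value it already holds
        brings \<open>E\<close> into the form required by \<open>rows_fix\<close>.\<close>
      have "(x(j := x (Suc j)))(Suc j := x (Suc j)) = x(j := x (Suc j))" by auto
      then have "E = rows m (Suc (Suc j)) ((x(j := x (Suc j)))(Suc j := x (Suc j)))"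
        by (simp add: E_def)
      also have "\<dots> = {l. (\<forall>i. i \<notin> {Suc j..m} \<longrightarrow> l i = (x(j := x (Suc j))) i) \<and> l (Suc j) = x (Suc j) \<and>
          (\<forall>i\<in>{j + 2..m}. x i \<le> l i \<and> l i \<le> x (Suc i)) \<and> (\<forall>i\<in>{j + 2..<m}. l i < l (Suc i))}"
        using jm by (subst rows_fix) auto
      also have "\<dots> = {l. (\<forall>i. i \<notin> {j..m} \<longrightarrow> l i = x i) \<and> l j = x (Suc j) \<and> l (Suc j) = x (Suc j) \<and>
          (\<forall>i\<in>{j + 2..m}. x i \<le> l i \<and> l i \<le> x (Suc i)) \<and> (\<forall>i\<in>{j + 2..<m}. l i < l (Suc i))}"
        unfolding agree_fix[OF j(2)] by simp
      finally show ?thesis .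
    qed
    have sub: "W - rows m j x \<subseteq> E"
    proof
      fix l assume "l \<in> W - rows m j x"
      then have l: "l \<in> W" "\<not> l j < l (Suc j)" unfolding strict by blast+
      have "l j \<le> x (Suc j)" "x (Suc j) \<le> l (Suc j)" using l(1) jm by (auto simp: W_def)
      then have "l j = x (Suc j)" "l (Suc j) = x (Suc j)" using l(2) by auto
      then show "l \<in> E" using l(1) unfolding E W_def by auto
    qed
    have zero: "f l = 0" if l: "l \<in> E - (W - rows m j x)" for l
    proof -
      have lj: "l j = x (Suc j)" "l (Suc j) = x (Suc j)" using l by (auto simp: E)
      then have "l \<notin> W" using l strict by auto
      moreover have "(\<forall>i. i \<notin> {j..m} \<longrightarrow> l i = x i)" using l by (auto simp: E)
      \<comment> \<open>Weak monotonicity of \<open>x\<close> puts the common value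
        \<open>x (Suc j)\<close> into the intervals of both \<open>l j\<close> and
        \<open>l (Suc j)\<close>. What can still keep \<open>l\<close> out of \<open>W\<close> is
        strictness.\<close>
      moreover have "x i \<le> l i \<and> l i \<le> x (Suc i)" if "i \<in> {j..m}" for i
      proof -
        have "i = j \<or> i = Suc j \<or> i \<in> {j + 2..m}" using that by auto
        then consider "i = j" | "i = Suc j" | "i \<in> {j + 2..m}" by blast
        then show ?thesis
          using l lj xle[of j "Suc j"] xle[of "Suc j" "Suc (Suc j)"] j jm by cases (auto simp: E)
      qed
      ultimately obtain i where i: "i \<in> {Suc j..<m}" "\<not> l i < l (Suc i)" unfolding W_def by blast
      have "i = Suc j"
      proof (rule ccontr)
        assume "i \<noteq> Suc j"
        then have "i \<in> {j + 2..<m}" using i(1) by auto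
        then show False using l i(2) by (auto simp: E)
      qed
      then have jm2: "j + 2 \<le> m" and le: "l (j + 2) \<le> l (Suc j)" using i by auto
      \<comment> \<open>The chain from \<open>l (Suc j) = x (Suc j)\<close> through
        \<open>x (j + 2)\<close> to \<open>l (j + 2)\<close> closes up with \<open>le\<close>, which
        makes three consecutive entries equal.\<close>
      have "x (Suc j) \<le> x (j + 2)" by (rule xle) (use jm2 in auto)
      moreover have "x (j + 2) \<le> l (j + 2)" using l jm2 by (auto simp: E)
      ultimately show ?thesis using triple[of j l] lj le j(1) jm2 by simp
    qed
    have "(\<Sum>l\<in>W. f l) = (\<Sum>l\<in>W - rows m j x. f l) + (\<Sum>l\<in>rows m j x. f l)"
      by (rule sum.subset_diff) (use strict \<open>finite W\<close> in auto)
    also have "(\<Sum>l\<in>W - rows m j x. f l) = (\<Sum>l\<in>E. f l)"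
      by (rule sum.mono_neutral_left) (use sub zero in \<open>auto simp: E_def finite_rows\<close>)
    finally show ?thesis using sumW False by (simp add: E_def)
  qed
qed

text \<open>Descent from \<open>j = Suc m\<close>, where the only row is \<open>x\<close> itself.
  The recursion refers to both \<open>j + 1\<close> and \<open>j + 2\<close>, hence the strong
  induction on the distance to \<open>Suc m\<close>.\<close>

lemma poly_on_sum_rows:
  assumes triple: "\<And>l i. 1 \<le> i \<Longrightarrow> i + 2 \<le> m \<Longrightarrow> l i = l (i + 1) \<Longrightarrow> l (i + 1) = l (i + 2) \<Longrightarrow> f l = 0"
    and f: "poly_on (Suc m) f" and "1 \<le> j" "j \<le> Suc m"
  shows "poly_on (Suc m) (\<lambda>x. \<Sum>l\<in>rows m j x. f l)"
  using assms(3,4)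
proof (induction "Suc m - j" arbitrary: j rule: less_induct)
  case less
  show ?case
  proof (cases "j = Suc m")
    case True
    then show ?thesis using f by (simp add: rows_empty)
  next
    case False
    then have j: "1 \<le> j" "j \<le> m" using less.prems by auto
    let ?U = "\<lambda>j x. \<Sum>l\<in>rows m j x. f l"
    have "poly_on (Suc m) (?U (Suc j))" by (rule less.hyps) (use j in auto)
    then have 1: "poly_on (Suc m) (\<lambda>x. \<Sum>v=x j..x (Suc j). ?U (Suc j) (x(j := v)))"
      by (rule poly_on_sum) (use j in auto)
    show ?thesis
    proof (cases "j = m")
      case True
      show ?thesis
        by (rule poly_on_cong[OF _ 1]) (use sum_rows_rec[where f = f, OF triple _ j] True in simp)
    next
      case False
      have "poly_on (Suc m) (?U (j + 2))" by (rule less.hyps) (use j False in auto)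
      then have 2: "poly_on (Suc m) (\<lambda>x. ?U (j + 2) (x(j := x (Suc j))))"
        by (rule poly_on_shift) (use j in auto)
      show ?thesis
        by (rule poly_on_cong[OF _ poly_on_diff[OF 1 2]])
          (use sum_rows_rec[where f = f, OF triple _ j] False in simp)
    qed
  qed
qed

section \<open>Removing the bottom row of a monotone triangle\<close>

lemma bij_betw_monotone_triangles:
  "bij_betw (\<lambda>(l, b). \<lambda>(i, j). if i = Suc m \<and> j \<in> {1..Suc m} then k j else b (i, j))
     (Sigma (rows m 1 k) (monotone_triangles m)) (monotone_triangles (Suc m) k)"
\<comment> \<open>The inverse cuts off the bottom row. Outside \<open>{1..m}\<close> the extracted
  row takes the values of \<open>k\<close>, as \<open>rows m 1 k\<close> prescribes.\<close>
proof (rule bij_betw_byWitness[where f' = "\<lambda>a. (\<lambda>i. if i \<in> {1..m} then a (m, i) else k i, restrict a (GT m))"])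
  let ?ext = "\<lambda>(l :: nat \<Rightarrow> int, b). \<lambda>(i, j). if i = Suc m \<and> j \<in> {1..Suc m} then k j else b (i, j)"
  let ?cut = "\<lambda>a. (\<lambda>i. if i \<in> {1..m} then a (m, i) else k i, restrict a (GT m))"
  show "\<forall>p\<in>Sigma (rows m 1 k) (monotone_triangles m). ?cut (?ext p) = p"
  proof
    fix p assume "p \<in> Sigma (rows m 1 k) (monotone_triangles m)"
    then obtain l b where p: "p = (l, b)" and l: "l \<in> rows m 1 k"
      and "b \<in> monotone_triangles m l" by blast
    then have b: "b \<in> gt_patterns m l" by (simp add: monotone_triangles_eq)
    have "(if i \<in> {1..m} then ?ext (l, b) (m, i) else k i) = l i" for i
    proof (cases "i \<in> {1..m}")
      case True
      then show ?thesis using gt_patterns_bottom[OF b] by auto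
    next
      case False
      then have "l i = k i" using l unfolding rows_def by blast
      then show ?thesis using False by (simp only: if_False)
    qed
    moreover have "restrict (?ext (l, b)) (GT m) p = b p" for p
    proof (cases "p \<in> GT m")
      case True
      then show ?thesis by (auto simp: GT_def)
    next
      case False
      then show ?thesis using gt_patterns_undefined[OF b] by simp
    qed
    ultimately have "restrict (?ext (l, b)) (GT m) = b"
      and "(\<lambda>i. if i \<in> {1..m} then ?ext (l, b) (m, i) else k i) = l"
      by blast+
    then show "?cut (?ext p) = p" unfolding p by (simp only: prod.inject simp_thms)
  qed
  show "\<forall>a\<in>monotone_triangles (Suc m) k. ?ext (?cut a) = a"
  proof
    fix a assume "a \<in> monotone_triangles (Suc m) k"
    then have a: "a \<in> gt_patterns (Suc m) k" by (simp add: monotone_triangles_eq)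
    have pt: "?ext (?cut a) (i, j) = a (i, j)" for i j
    proof (cases "i = Suc m \<and> j \<in> {1..Suc m}")
      case True
      then show ?thesis using gt_patterns_bottom[OF a] by auto
    next
      case False
      show ?thesis
      proof (cases "(i, j) \<in> GT m")
        case True
        then show ?thesis using False by auto
      next
        case f: False
        then have "(i, j) \<notin> GT (Suc m)" using False by (auto simp: GT_def)
        then have "a (i, j) = undefined" by (rule gt_patterns_undefined[OF a])
        then show ?thesis using False f by auto
      qed
    qed
    show "?ext (?cut a) = a"
    proof
      fix p :: pos
      obtain i j where p: "p = (i, j)" by (cases p)
      show "?ext (?cut a) p = a p" unfolding p by (rule pt)
    qed
  qed
  show "?ext ` Sigma (rows m 1 k) (monotone_triangles m) \<subseteq> monotone_triangles (Suc m) k"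
  proof (rule image_subsetI)
    fix p assume "p \<in> Sigma (rows m 1 k) (monotone_triangles m)"
    then obtain l b where p: "p = (l, b)" and l: "l \<in> rows m 1 k"
      and "b \<in> monotone_triangles m l" by blast
    then have b: "b \<in> gt_patterns m l" and v: "violations m b = {}"
      by (auto simp: monotone_triangles_eq)
    define a where "a = ?ext (l, b)"
    have old: "a (i, j) = b (i, j)" if "i \<le> m" for i j using that by (simp add: a_def)
    have new: "a (Suc m, j) = k j" if "1 \<le> j" "j \<le> Suc m" for j using that by (simp add: a_def)
    have bl: "b (m, j) = l j" if "1 \<le> j" "j \<le> m" for j using gt_patterns_bottom[OF b that] .
    have lk: "k j \<le> l j" "l j \<le> k (Suc j)" if "1 \<le> j" "j \<le> m" for j
      using l that by (auto simp: rows_def)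
    have inter: "a (Suc i, j) \<le> a (i, j) \<and> a (i, j) \<le> a (Suc i, Suc j)"
      if "1 \<le> j \<and> j \<le> i \<and> i < Suc m" for i j
    proof (cases "i = m")
      case True
      then show ?thesis using that lk bl by (simp add: old new)
    next
      case False
      then show ?thesis using that gt_patternsD[OF b, of j i] by (simp add: old)
    qed
    have "a (i, j) = undefined" if "(i, j) \<notin> GT (Suc m)" for i j
    proof -
      have "(i, j) \<notin> GT m" "\<not> (i = Suc m \<and> j \<in> {1..Suc m})" using that by (auto simp: GT_def)
      then show ?thesis using gt_patterns_undefined[OF b, of "(i, j)"] by (auto simp: a_def)
    qed
    then have "a \<in> GT (Suc m) \<rightarrow>\<^sub>E UNIV" by (auto simp: PiE_def extensional_def)
    then have "a \<in> gt_patterns (Suc m) k" using inter new unfolding gt_patterns_def by auto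
    moreover have "(i, j) \<notin> violations (Suc m) a" for i j
    proof
      assume "(i, j) \<in> violations (Suc m) a"
      then have ij: "1 \<le> j" "j < i" "i \<le> m" "b (i, j) = b (i, Suc j)"
        by (auto simp: violations_def bad_def old)
      \<comment> \<open>Row \<open>m\<close> is the bottom row of \<open>b\<close> and so outside
        \<open>bad m\<close>; its strictness comes from \<open>rows\<close>, that of the higher rows
        from \<open>b\<close>.\<close>
      show False
      proof (cases "i = m")
        case True
        have "l j < l (Suc j)" using l ij by (auto simp: rows_def)
        then show False using ij bl True by simp
      next
        case False
        then show False using ij v by (auto simp: violations_def bad_def)
      qed
    qed
    ultimately have "a \<in> monotone_triangles (Suc m) k"
      unfolding monotone_triangles_eq by auto
    then show "?ext p \<in> monotone_triangles (Suc m) k" by (simp only: a_def p)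
  qed
  show "?cut ` monotone_triangles (Suc m) k \<subseteq> Sigma (rows m 1 k) (monotone_triangles m)"
  proof (rule image_subsetI)
    fix a assume "a \<in> monotone_triangles (Suc m) k"
    then have a: "a \<in> gt_patterns (Suc m) k" and v: "violations (Suc m) a = {}"
      by (auto simp: monotone_triangles_eq)
    define l where "l = (\<lambda>i. if i \<in> {1..m} then a (m, i) else k i)"
    define b where "b = restrict a (GT m)"
    have ab: "b (i, j) = a (i, j)" if "1 \<le> j" "j \<le> i" "i \<le> m" for i j
      using that by (simp add: b_def GT_def)
    have strict: "a (i, j) < a (i, Suc j)" if "1 \<le> j" "j < i" "i \<le> m" for i j
    proof -
      have "a (i, j) \<noteq> a (i, Suc j)" using v that by (auto simp: violations_def bad_def)
      then show ?thesis using gt_patterns_row_le[OF a, of j i] that by simp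
    qed
    have "k j \<le> a (m, j)" "a (m, j) \<le> k (Suc j)" if "1 \<le> j" "j \<le> m" for j
      using gt_patternsD[OF a, of j m] gt_patterns_bottom[OF a, of j]
        gt_patterns_bottom[OF a, of "Suc j"] that by auto
    then have "l \<in> rows m 1 k" using strict[of _ m] by (auto simp: rows_def l_def)
    moreover have "b \<in> gt_patterns m l"
      using gt_patternsD[OF a] unfolding gt_patterns_def by (auto simp: b_def l_def GT_def)
    moreover have "violations m b = {}"
      using v by (auto simp: violations_def bad_def b_def GT_def)
    ultimately show "?cut a \<in> Sigma (rows m 1 k) (monotone_triangles m)"
      by (simp add: monotone_triangles_eq l_def b_def)
  qed
qed

lemma alpha_Suc: "alpha (Suc m) k = (\<Sum>l\<in>rows m 1 k. alpha m l)"
proof -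
  have "finite (monotone_triangles m l)" for l
    using finite_gt_patterns by (simp add: monotone_triangles_eq)
  then show ?thesis
    using bij_betw_same_card[OF bij_betw_monotone_triangles[of m k]]
    by (simp add: alpha_def card_SigmaI finite_rows)
qed

text \<open>Induction along \<open>alpha_Suc\<close>: the count for \<open>m\<close> rows is read as
  a function of \<open>Suc m\<close> variables, and \<open>alpha_triple\<close> supplies the
  vanishing that \<open>poly_on_sum_rows\<close> requires.\<close>

lemma poly_on_alpha: "poly_on n (\<lambda>k. int (alpha n k))"
proof (induction n)
  case 0
  \<comment> \<open>The empty triangle is the everywhere undefined function, so the count for 0 rows
    is 1.\<close>
  have "gt_patterns 0 k = {\<lambda>_. undefined}" "violations 0 a = {}" for k a
    by (auto simp: gt_patterns_def violations_def bad_def GT_def)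
  then have "alpha 0 k = 1" for k by (simp add: alpha_def monotone_triangles_eq)
  then show ?case unfolding poly_on_def by (intro bexI[of _ "\<lambda>x. 1"] polyfun_const) auto
next
  case (Suc m)
  have "poly_on (Suc m) (\<lambda>x. \<Sum>l\<in>rows m 1 x. int (alpha m l))"
    by (rule poly_on_sum_rows) (use poly_on_mono[OF Suc] alpha_triple in auto)
  then show ?case by (simp add: alpha_Suc)
qed

theorem theorem3p7:
  fixes n :: nat
  assumes "n \<ge> 1"
  shows "(\<forall>k. mono_on {1..n} k \<longrightarrow>
            int (alpha n k) = (\<Sum>G \<in> Q_ess n. (-1) ^ card (I_set n G) * int (Omega n G k)))
       \<and> (\<exists>P. mpol_in {1..n} P \<and>
            (\<forall>k. mono_on {1..n} k \<longrightarrow> of_nat (alpha n k) = mpol_eval P (\<lambda>j. of_int (k j))))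
       \<and> (\<forall>k. mono_on {1..n} k \<longrightarrow>
            (\<forall>j. 1 \<le> j \<and> j + 2 \<le> n \<and> k j = k (j + 1) \<and> k (j + 1) = k (j + 2) \<longrightarrow> alpha n k = 0))"
proof -
  obtain p where p: "p \<in> polyfun {1..n}"
    "\<And>k. mono_on {1..n} k \<Longrightarrow> of_int (int (alpha n k)) = p (\<lambda>j. of_int (k j))"
    using poly_on_alpha[of n] unfolding poly_on_def by blast
  obtain P where P: "mpol_in {1..n} P" "\<And>x. p x = mpol_eval P x"
    using polyfun_mpol_eval[OF p(1)] by blast
  have "of_nat (alpha n k) = mpol_eval P (\<lambda>j. of_int (k j))" if "mono_on {1..n} k" for k
    using p(2)[OF that] by (simp add: P(2))
  then show ?thesis using P(1) alpha_eq_sum_Omega alpha_triple by blast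
qed

end
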